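(* Let $d\ge2$ and let $\Omega\subsetneq\mathbb R^d$ be a convex domain. For any $(\alpha^{ij})_{d\times d}\in\bigcup_{0<\nu\le1}\mathrm M(\nu^2,1)$, $$\sum_{i,j=1}^d\alpha^{ij}D_{ij}\rho\le0$$ in the sense of distributions on $\Omega$.
   Context: $\rho(x)=d(x,\partial\Omega)$. $\mathrm M(\nu_1,\nu_2)$ is the set of real symmetric $d\times d$ matrices $(\alpha^{ij})$ with $\nu_1|\xi|^2\le\sum\alpha^{ij}\xi_i\xi_j\le\nu_2|\xi|^2$ for all $\xi\in\mathbb R^d$. For a distribution $F$ on $\Omega$, $F\le0$ means $\langle F,\zeta\rangle\le0$ for all $0\le\zeta\in C_c^\infty(\Omega)$. *)

theory Defs
  imports "HOL-Analysis.Analysis"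
begin

definition bdry_dist :: "(real ^ 'n) set \<Rightarrow> real ^ 'n \<Rightarrow> real" where
  "bdry_dist \<Omega> x = infdist x (frontier \<Omega>)"

definition elliptic_matrices :: "real \<Rightarrow> real \<Rightarrow> (real ^ 'n ^ 'n) set" where
  "elliptic_matrices \<nu>\<^sub>1 \<nu>\<^sub>2 =
     {\<alpha>. transpose \<alpha> = \<alpha> \<and>
         (\<forall>\<xi>. \<nu>\<^sub>1 * (norm \<xi>)\<^sup>2 \<le> (\<Sum>i\<in>UNIV. \<Sum>j\<in>UNIV. \<alpha> $ i $ j * \<xi> $ i * \<xi> $ j) \<and>
              (\<Sum>i\<in>UNIV. \<Sum>j\<in>UNIV. \<alpha> $ i $ j * \<xi> $ i * \<xi> $ j) \<le> \<nu>\<^sub>2 * (norm \<xi>)\<^sup>2)}"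

text \<open>Only meaningful where \<open>f\<close> is differentiable; below it is applied to smooth functions only.\<close>

definition partial_deriv :: "'n::finite \<Rightarrow> (real ^ 'n \<Rightarrow> real) \<Rightarrow> real ^ 'n \<Rightarrow> real" where
  "partial_deriv i f x = frechet_derivative f (at x) (axis i 1)"

primrec C_order :: "nat \<Rightarrow> (real ^ 'n::finite \<Rightarrow> real) \<Rightarrow> bool" where
  "C_order 0 f \<longleftrightarrow> continuous_on UNIV f"
| "C_order (Suc k) f \<longleftrightarrow> (\<forall>x. f differentiable (at x)) \<and> (\<forall>i. C_order k (partial_deriv i f))"

definition C_infinity :: "(real ^ 'n::finite \<Rightarrow> real) \<Rightarrow> bool" where
  "C_infinity f \<longleftrightarrow> (\<forall>k. C_order k f)"

text \<open>Elements of \<open>C\<^sub>c\<^sup>\<infinity>(\<Omega>)\<close> are taken to be extended by zero to the whole space.\<close>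

definition test_functions :: "(real ^ 'n::finite) set \<Rightarrow> (real ^ 'n \<Rightarrow> real) set" where
  "test_functions \<Omega> =
     {\<zeta>. C_infinity \<zeta> \<and> compact (closure {x. \<zeta> x \<noteq> 0}) \<and> closure {x. \<zeta> x \<noteq> 0} \<subseteq> \<Omega>}"

text \<open>
  A distribution on \<open>\<Omega>\<close> is represented by its action \<open>\<zeta> \<mapsto> \<langle>F, \<zeta>\<rangle>\<close>; only the values on
  test functions of \<open>\<Omega>\<close> matter. Continuity of the functional plays no role in the order
  relation \<open>F \<le> 0\<close> and is not recorded.
\<close>

type_synonym 'n distr = "(real ^ 'n \<Rightarrow> real) \<Rightarrow> real"

definition distr_of_fun :: "(real ^ 'n::finite) set \<Rightarrow> (real ^ 'n \<Rightarrow> real) \<Rightarrow> 'n distr" where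
  "distr_of_fun \<Omega> f \<zeta> = (LINT x:\<Omega>|lebesgue. f x * \<zeta> x)"

definition distr_deriv :: "'n::finite \<Rightarrow> 'n distr \<Rightarrow> 'n distr" where
  "distr_deriv i F \<zeta> = - F (partial_deriv i \<zeta>)"

definition distr_nonpos :: "(real ^ 'n::finite) set \<Rightarrow> 'n distr \<Rightarrow> bool" where
  "distr_nonpos \<Omega> F \<longleftrightarrow> (\<forall>\<zeta>\<in>test_functions \<Omega>. (\<forall>x. 0 \<le> \<zeta> x) \<longrightarrow> F \<zeta> \<le> 0)"

end

theory Submission
  imports Defs
begin

text \<open>
  The distance to the boundary of a convex set is concave, so its second differences along any
  direction are nonpositive. Moving second differences onto the test function and passing to the
  limit shows that \<open>D\<^sub>v\<^sub>v \<rho> \<le> 0\<close> for every vector \<open>v\<close>. A positive semidefinite \<open>\<alpha>\<close> is a sum of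
  matrices \<open>v v\<^sup>T\<close>, so the general operator is a sum of such pure second derivatives.
\<close>

section \<open>Positive semidefinite matrices as sums of squares\<close>

text \<open>The left side is the form at \<open>x - t e_s\<close>. Read as a quadratic polynomial in
  \<open>t\<close>, its nonnegativity drives both cases of the elimination below.\<close>

lemma quadratic_form_update:
  fixes a :: "'n::finite \<Rightarrow> 'n \<Rightarrow> real"
  assumes sym: "\<And>i j. a i j = a j i"
  shows "(\<Sum>i\<in>UNIV. \<Sum>j\<in>UNIV. a i j * (x i - (if i = s then t else 0)) * (x j - (if j = s then t else 0)))
    = (\<Sum>i\<in>UNIV. \<Sum>j\<in>UNIV. a i j * x i * x j) - 2 * t * (\<Sum>j\<in>UNIV. a s j * x j) + t\<^sup>2 * a s s"
proof -
  have "(\<Sum>i\<in>UNIV. \<Sum>j\<in>UNIV. a i j * (x i - (if i = s then t else 0)) * (x j - (if j = s then t else 0)))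
    = (\<Sum>i\<in>UNIV. \<Sum>j\<in>UNIV. a i j * x i * x j - (if i = s then t * (a i j * x j) else 0)
        - (if j = s then t * (a i j * x i) else 0) + (if i = s then if j = s then t\<^sup>2 * a s s else 0 else 0))"
    by (intro sum.cong) (auto simp: algebra_simps power2_eq_square)
  also have "\<dots> = (\<Sum>i\<in>UNIV. \<Sum>j\<in>UNIV. a i j * x i * x j) - t * (\<Sum>j\<in>UNIV. a s j * x j)
      - t * (\<Sum>i\<in>UNIV. a i s * x i) + t\<^sup>2 * a s s"
    (is "_ = ?Q - ?A - ?B + ?C")
  proof -
    have "(\<Sum>i\<in>UNIV. \<Sum>j\<in>UNIV. (if i = s then t * (a i j * x j) else 0)) = ?A"
      by (subst sum.swap) (simp add: sum_distrib_left)
    moreover have "(\<Sum>i\<in>UNIV. \<Sum>j\<in>UNIV. (if j = s then t * (a i j * x i) else 0)) = ?B"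
      by (simp add: sum_distrib_left)
    moreover have "(\<Sum>i\<in>UNIV. \<Sum>j\<in>UNIV. (if i = s then if j = s then t\<^sup>2 * a s s else 0 else 0)) = ?C"
      by (subst sum.swap) simp
    ultimately show ?thesis
      by (simp only: sum.distrib sum_subtractf)
  qed
  also have "(\<Sum>i\<in>UNIV. a i s * x i) = (\<Sum>j\<in>UNIV. a s j * x j)"
    by (simp add: sym[of _ s])
  finally show ?thesis by simp
qed

text \<open>Symmetric Gaussian elimination, as in the Cholesky factorisation. The induction runs
  over an index set \<open>S\<close> carrying the nonzero rows, hence by symmetry the nonzero
  columns; each step clears one index \<open>s\<close>.\<close>

lemma psd_sum_of_squares_on:
  fixes a :: "'n::finite \<Rightarrow> 'n \<Rightarrow> real"
  assumes "finite S" and "\<And>i j. a i j = a j i"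
    and "\<And>x. 0 \<le> (\<Sum>i\<in>UNIV. \<Sum>j\<in>UNIV. a i j * x i * x j)"
    and "\<And>i j. i \<notin> S \<Longrightarrow> a i j = 0"
  shows "\<exists>V::('n \<Rightarrow> real) list. \<forall>i j. a i j = (\<Sum>v\<leftarrow>V. v i * v j)"
  using assms
proof (induction S arbitrary: a rule: finite_induct)
  case empty
  then show ?case by (intro exI[of _ "[]"]) simp
next
  case (insert s S)
  note sym = insert.prems(1) and psd = insert.prems(2) and supp = insert.prems(3)
  have ass: "0 \<le> a s s"
  proof -
    have "(\<Sum>i\<in>UNIV. \<Sum>j\<in>UNIV. a i j * (if i = s then 1 else 0) * (if j = s then 1 else 0)) = a s s"
      by (simp add: if_distrib[of "(*) _"] cong: if_cong)
    then show ?thesis using psd[of "\<lambda>i. if i = s then 1 else 0"] by simp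
  qed
  have shift: "0 \<le> (\<Sum>i\<in>UNIV. \<Sum>j\<in>UNIV. a i j * x i * x j)
      - 2 * t * (\<Sum>j\<in>UNIV. a s j * x j) + t\<^sup>2 * a s s" for x t
    using psd[of "\<lambda>i. x i - (if i = s then t else 0)"] quadratic_form_update[of a x s t, OF sym]
    by simp
  show ?case
  proof (cases "a s s = 0")
    case True
    have "a s j = 0" for j
    proof (rule ccontr)
      assume nz: "a s j \<noteq> 0"
      define q where "q = a j j"
      \<comment> \<open>At \<open>e_j - t e_s\<close> the form equals
        \<open>q - 2 * t * a s j\<close>, which is affine in \<open>t\<close>; this choice makes it
        -1.\<close>
      define t where "t = (q + 1) / (2 * a s j)"
      have e1: "(\<Sum>i\<in>UNIV. \<Sum>k\<in>UNIV. a i k * (if i = j then 1 else 0) * (if k = j then 1 else 0)) = q"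
        by (simp add: q_def if_distrib[of "(*) _"] cong: if_cong)
      have e2: "(\<Sum>k\<in>UNIV. a s k * (if k = j then 1 else 0)) = a s j"
        by (simp add: if_distrib cong: if_cong)
      have "0 \<le> q - 2 * t * a s j"
        using shift[of "\<lambda>i. if i = j then 1 else 0" t] True e1 e2 by simp
      moreover have "2 * t * a s j = q + 1" using nz by (simp add: t_def)
      ultimately show False by simp
    qed
    then have "i \<notin> S \<Longrightarrow> a i j = 0" for i j
      using supp[of i j] by (cases "i = s") auto
    from insert.IH[OF sym psd this] show ?thesis by simp
  next
    case False
    with ass have pos: "a s s > 0" by simp
    \<comment> \<open>Schur complement of the pivot \<open>a s s\<close>: subtracting this rank-one
      matrix clears row and column \<open>s\<close>.\<close>
    define b where "b i j = a i j - a s i * a s j / a s s" for i j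
    have "b i j = b j i" for i j by (simp add: b_def sym[of i j])
    moreover have "0 \<le> (\<Sum>i\<in>UNIV. \<Sum>j\<in>UNIV. b i j * x i * x j)" for x
    proof -
      let ?L = "\<Sum>j\<in>UNIV. a s j * x j"
      have "(\<Sum>i\<in>UNIV. \<Sum>j\<in>UNIV. b i j * x i * x j)
          = (\<Sum>i\<in>UNIV. \<Sum>j\<in>UNIV. a i j * x i * x j - (a s i * x i) * (a s j * x j) / a s s)"
        by (simp add: b_def algebra_simps)
      also have "\<dots> = (\<Sum>i\<in>UNIV. \<Sum>j\<in>UNIV. a i j * x i * x j) - ?L * ?L / a s s"
        by (simp add: sum_subtractf sum_product flip: sum_divide_distrib)
      \<comment> \<open>Completing the square: this is \<open>shift\<close> at the minimising
        \<open>t = ?L / a s s\<close>, so semidefiniteness passes to \<open>b\<close>.\<close>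
      also have "\<dots> = (\<Sum>i\<in>UNIV. \<Sum>j\<in>UNIV. a i j * x i * x j)
          - 2 * (?L / a s s) * ?L + (?L / a s s)\<^sup>2 * a s s"
        using pos by (simp add: field_simps power2_eq_square)
      also have "\<dots> \<ge> 0" by (rule shift)
      finally show ?thesis .
    qed
    moreover have "i \<notin> S \<Longrightarrow> b i j = 0" for i j
      using supp[of i] sym[of s i] pos by (cases "i = s") (auto simp: b_def)
    ultimately obtain V where V: "\<forall>i j. b i j = (\<Sum>v\<leftarrow>V. v i * v j)"
      using insert.IH[of b] by blast
    \<comment> \<open>The outer product of the new vector with itself restores the subtracted
      rank-one matrix.\<close>
    have "a i j = (\<Sum>v\<leftarrow>(\<lambda>i. a s i / sqrt (a s s)) # V. v i * v j)" for i j
      using V[rule_format, of i j] pos by (simp add: b_def)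
    then show ?thesis by blast
  qed
qed

text \<open>Writing \<alpha> as a sum of matrices \<open>v v^T\<close> splits the contraction into
  values of the quadratic form of \<open>L\<close>. Later \<open>L i j\<close> is the action of a
  mixed second derivative of the distance on a test function.\<close>

lemma psd_contraction_nonpos:
  fixes \<alpha> :: "real ^ 'n ^ 'n" and L :: "'n::finite \<Rightarrow> 'n \<Rightarrow> real"
  assumes "transpose \<alpha> = \<alpha>"
    and psd: "\<And>\<xi> :: real ^ 'n. 0 \<le> (\<Sum>i\<in>UNIV. \<Sum>j\<in>UNIV. \<alpha> $ i $ j * \<xi> $ i * \<xi> $ j)"
    and L: "\<And>v :: real ^ 'n. (\<Sum>i\<in>UNIV. \<Sum>j\<in>UNIV. v $ i * v $ j * L i j) \<le> 0"
  shows "(\<Sum>i\<in>UNIV. \<Sum>j\<in>UNIV. \<alpha> $ i $ j * L i j) \<le> 0"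
proof -
  have "\<alpha> $ i $ j = \<alpha> $ j $ i" for i j
    using arg_cong[OF assms(1), of "\<lambda>A. A $ i $ j"] by (simp add: transpose_def)
  moreover have "0 \<le> (\<Sum>i\<in>UNIV. \<Sum>j\<in>UNIV. \<alpha> $ i $ j * x i * x j)" for x
    using psd[of "\<chi> i. x i"] by simp
  ultimately obtain V where V: "\<And>i j. \<alpha> $ i $ j = (\<Sum>v\<leftarrow>V. v i * v j)"
    using psd_sum_of_squares_on[of UNIV "\<lambda>i j. \<alpha> $ i $ j"] by auto
  have "(\<Sum>i\<in>UNIV. \<Sum>j\<in>UNIV. (\<Sum>v\<leftarrow>V. v i * v j) * L i j)
      = (\<Sum>v\<leftarrow>V. \<Sum>i\<in>UNIV. \<Sum>j\<in>UNIV. v i * v j * L i j)"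
    by (induction V) (simp_all add: distrib_right sum.distrib)
  also have "\<dots> \<le> 0"
    using L[of "\<chi> i. v i" for v] by (intro sum_list_nonpos) auto
  finally show ?thesis by (simp add: V)
qed

section \<open>Concavity of the distance to the boundary\<close>

text \<open>A connected set meeting both \<open>S\<close> and its complement meets the frontier, but
  the open ball of this radius contains no frontier point. For an empty frontier
  \<open>infdist\<close> is 0 and the ball is empty.\<close>

lemma ball_infdist_frontier_subset:
  fixes x :: "'a::real_normed_vector"
  assumes "x \<in> S"
  shows "ball x (infdist x (frontier S)) \<subseteq> S"
proof (rule ccontr)
  let ?B = "ball x (infdist x (frontier S))"
  assume "\<not> ?B \<subseteq> S"
  then obtain y where y: "y \<in> ?B" "y \<notin> S" by blast
  \<comment> \<open>A point in the ball forces a positive radius, so the centre lies in the ball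
    too.\<close>
  then have "0 < infdist x (frontier S)"
    using zero_le_dist[of x y] unfolding mem_ball by linarith
  then have "x \<in> ?B \<inter> S" using assms by simp
  then have "?B \<inter> S \<noteq> {}" by blast
  then obtain z where "z \<in> ?B" "z \<in> frontier S"
    using connected_Int_frontier[of ?B S] y connected_ball by blast
  then show False using infdist_le[of z "frontier S" x] by simp
qed

text \<open>The balls about \<open>x + w\<close> and \<open>x - w\<close> whose radii are the
  boundary distances lie in \<open>S\<close>. By convexity their average, a ball about
  \<open>x\<close> with the mean radius, lies in \<open>S\<close> as well, and the open set
  \<open>S\<close> contains no frontier point.\<close>

lemma infdist_frontier_midpoint_concave:
  fixes x w :: "'a::euclidean_space"
  assumes "open S" "convex S" "S \<noteq> UNIV" and p: "x + w \<in> S" "x - w \<in> S"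
  shows "infdist (x + w) (frontier S) + infdist (x - w) (frontier S) \<le> 2 * infdist x (frontier S)"
proof -
  define a b where "a = infdist (x + w) (frontier S)" and "b = infdist (x - w) (frontier S)"
  \<comment> \<open>This excludes the default value 0 of \<open>infdist\<close> to the empty
    set.\<close>
  have ne: "frontier S \<noteq> {}"
    using assms by (auto simp: frontier_eq_empty)
  have disj: "frontier S \<inter> S = {}"
    using \<open>open S\<close> by (simp add: frontier_def interior_open) blast
  have pos: "0 < infdist y (frontier S)" if "y \<in> S" for y
    using that disj ne by (intro infdist_pos_not_in_closed) auto
  have ab: "a > 0" "b > 0" using pos p by (auto simp: a_def b_def)
  have "(a + b) / 2 \<le> dist x z" if z: "z \<in> frontier S" for z
  proof (rule ccontr)
    assume less: "\<not> (a + b) / 2 \<le> dist x z"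
    \<comment> \<open>The rescaled offset lies in the open unit ball, and \<open>z\<close> is the
      midpoint of \<open>x + w + a u\<close> and \<open>x - w + b u\<close>.\<close>
    define u where "u = (2 / (a + b)) *\<^sub>R (z - x)"
    have nu: "norm u < 1"
      using less ab by (simp add: u_def dist_norm norm_minus_commute divide_less_eq)
    have "(a + b) / 2 * (2 / (a + b)) = 1" using ab by simp
    then have zu: "z = x + ((a + b) / 2) *\<^sub>R u"
      unfolding u_def scaleR_scaleR by (metis add.commute diff_add_cancel scaleR_one)
    have "x + w + a *\<^sub>R u \<in> ball (x + w) a" "x - w + b *\<^sub>R u \<in> ball (x - w) b"
      using nu ab by (auto simp: dist_norm)
    then have "x + w + a *\<^sub>R u \<in> S" "x - w + b *\<^sub>R u \<in> S"
      using ball_infdist_frontier_subset[OF p(1)] ball_infdist_frontier_subset[OF p(2)]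
      unfolding a_def b_def by blast+
    then have "(1/2) *\<^sub>R (x + w + a *\<^sub>R u) + (1/2) *\<^sub>R (x - w + b *\<^sub>R u) \<in> S"
      using \<open>convex S\<close> by (intro convexD) auto
    also have "(1/2) *\<^sub>R (x + w + a *\<^sub>R u) + (1/2) *\<^sub>R (x - w + b *\<^sub>R u) = z"
    proof -
      have "(1/2) *\<^sub>R x + ((1/2) *\<^sub>R x + t) = x + t" for t
        by (simp flip: add.assoc scaleR_add_left)
      then show ?thesis
        unfolding zu by (simp add: algebra_simps add_divide_distrib)
    qed
    finally show False using z disj by blast
  qed
  then have "(a + b) / 2 \<le> infdist x (frontier S)"
    unfolding infdist_notempty[OF ne] by (intro cINF_greatest[OF ne])
  then show ?thesis by (simp add: a_def b_def)
qed

section \<open>Second differences against a test function\<close>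

lemma integrable_continuous_compact_support:
  fixes f :: "'a::euclidean_space \<Rightarrow> real"
  assumes "continuous_on UNIV f" "compact K" "\<And>x. x \<notin> K \<Longrightarrow> f x = 0"
  shows "integrable lborel f"
proof -
  have "integrable lborel (\<lambda>x. indicator K x *\<^sub>R f x)"
    using assms by (intro borel_integrable_compact continuous_on_subset[OF assms(1)]) auto
  also have "(\<lambda>x. indicator K x *\<^sub>R f x) = f"
    using assms(3) by (force simp: indicator_def)
  finally show ?thesis .
qed

lemma integral_lborel_translation:
  fixes f :: "'a::euclidean_space \<Rightarrow> real"
  assumes "continuous_on UNIV f"
  shows "(LINT x|lborel. f (c + x)) = (LINT x|lborel. f x)"
proof -
  have "(LINT x|distr lborel borel ((+) c). f x) = (LINT x|lborel. f (c + x))"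
    using assms by (intro integral_distr) (auto intro: borel_measurable_continuous_onI)
  then show ?thesis by (simp add: lborel_distr_plus)
qed

text \<open>The Taylor points are allowed on either side of the origin, which is enough for the limit.\<close>

lemma second_difference_mean_value:
  fixes f :: "real \<Rightarrow> real"
  assumes "\<And>t. (f has_real_derivative f' t) (at t)" "\<And>t. (f' has_real_derivative f'' t) (at t)"
    and "h > 0"
  shows "\<exists>s t. \<bar>s\<bar> \<le> h \<and> \<bar>t\<bar> \<le> h \<and> (f h + f (- h) - 2 * f 0) / h\<^sup>2 = (f'' s + f'' t) / 2"
proof -
  define diff where "diff m = (if m = 0 then f else if m = 1 then f' else f'')" for m :: nat
  have D: "\<forall>m t. m < 2 \<and> \<bar>t\<bar> \<le> \<bar>k\<bar> \<longrightarrow> DERIV (diff m) t :> diff (Suc m) t" for k :: real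
    using assms by (auto simp: diff_def)
  have T: "\<exists>t. \<bar>t\<bar> \<le> \<bar>k\<bar> \<and> f k = f 0 + f' 0 * k + f'' t / 2 * k\<^sup>2" for k
    using Maclaurin_bi_le[of diff f 2 k, OF _ D] by (simp add: diff_def numeral_2_eq_2)
  obtain s where s: "\<bar>s\<bar> \<le> h" "f h = f 0 + f' 0 * h + f'' s / 2 * h\<^sup>2"
    using T[of h] \<open>h > 0\<close> by auto
  obtain t where t: "\<bar>t\<bar> \<le> h" "f (- h) = f 0 - f' 0 * h + f'' t / 2 * h\<^sup>2"
    using T[of "- h"] \<open>h > 0\<close> by auto
  \<comment> \<open>The first-order terms of the two expansions cancel, leaving the mean of the
    remainders.\<close>
  have "(f h + f (- h) - 2 * f 0) / h\<^sup>2 = (f'' s + f'' t) / 2"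
    unfolding s(2) t(2) using \<open>h > 0\<close> by (simp add: field_simps)
  with s(1) t(1) show ?thesis by blast
qed

text \<open>Discrete integration by parts: translation invariance moves the second difference in
  direction \<open>v\<close> from \<open>f\<close> to \<open>r\<close>, where concavity on the
  support of \<open>f\<close> gives the sign. Dominated convergence then lets the step tend to
  0.\<close>

lemma second_derivative_integral_nonpos:
  fixes r f f' f'' :: "'a::euclidean_space \<Rightarrow> real"
  assumes r: "continuous_on UNIV r" and f: "continuous_on UNIV f" and f'': "continuous_on UNIV f''"
    and d1: "\<And>x t. ((\<lambda>t. f (x + t *\<^sub>R v)) has_real_derivative f' (x + t *\<^sub>R v)) (at t)"
    and d2: "\<And>x t. ((\<lambda>t. f' (x + t *\<^sub>R v)) has_real_derivative f'' (x + t *\<^sub>R v)) (at t)"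
    and K: "compact K" and fK: "\<And>x. x \<notin> K \<Longrightarrow> f x = 0" and f''K: "\<And>x. x \<notin> K \<Longrightarrow> f'' x = 0"
    and nonneg: "\<And>x. 0 \<le> f x"
    and "e > 0"
    and concave: "\<And>x h. x \<in> K \<Longrightarrow> 0 < h \<Longrightarrow> h \<le> e \<Longrightarrow> r (x + h *\<^sub>R v) + r (x - h *\<^sub>R v) \<le> 2 * r x"
  shows "(LINT x|lborel. r x * f'' x) \<le> 0"
proof -
  define q where "q h x = (f (x + h *\<^sub>R v) + f (x - h *\<^sub>R v) - 2 * f x) / h\<^sup>2" for h x
  \<comment> \<open>A single compact set outside which all difference quotients with steps in
    \<open>(0, e]\<close> vanish.\<close>
  define K' where "K' = (\<Union>x\<in>K. cball x (e * norm v))"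
  have K': "compact K'" unfolding K'_def by (rule compact_minkowski_sum_cball[OF K])
  have out: "x + s *\<^sub>R v \<notin> K" if "x \<notin> K'" "\<bar>s\<bar> \<le> e" for x s
  proof
    assume "x + s *\<^sub>R v \<in> K"
    moreover have "x \<in> cball (x + s *\<^sub>R v) (e * norm v)"
      using that(2) by (simp add: dist_norm mult_right_mono)
    ultimately show False using that(1) unfolding K'_def by blast
  qed
  have outK: "x \<notin> K" if "x \<notin> K'" for x
    using out[OF that, of 0] \<open>e > 0\<close> by simp
  have "bounded (f'' ` K)"
    using K f'' by (intro compact_imp_bounded compact_continuous_image continuous_on_subset[OF f'']) auto
  then obtain B where "\<forall>x\<in>K. \<bar>f'' x\<bar> \<le> B" and "B > 0"
    by (auto simp: bounded_pos)
  then have B: "\<bar>f'' x\<bar> \<le> B" for x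
    using f''K[of x] by (cases "x \<in> K") auto
  have mv: "\<exists>s t. \<bar>s\<bar> \<le> h \<and> \<bar>t\<bar> \<le> h \<and> q h x = (f'' (x + s *\<^sub>R v) + f'' (x + t *\<^sub>R v)) / 2"
    if "h > 0" for h x
    using second_difference_mean_value[OF d1 d2 that, of x] by (simp add: q_def)
  \<comment> \<open>The mean value form bounds the quotients uniformly in \<open>h\<close>, as
    domination requires.\<close>
  have qB: "\<bar>q h x\<bar> \<le> B" if h: "h > 0" for h x
  proof -
    obtain s t where "q h x = (f'' (x + s *\<^sub>R v) + f'' (x + t *\<^sub>R v)) / 2"
      using mv[OF h, of x] by blast
    then show ?thesis using B[of "x + s *\<^sub>R v"] B[of "x + t *\<^sub>R v"] by simp
  qed
  have q0: "q h x = 0" if "0 < h" "h \<le> e" "x \<notin> K'" for h x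
    using out[OF that(3), of h] out[OF that(3), of "- h"] outK[OF that(3)] that fK
    by (simp add: q_def)
  have cont_shift: "continuous_on UNIV (\<lambda>x. g (x + c))" if "continuous_on UNIV g" for g :: "'a \<Rightarrow> real" and c
    by (rule continuous_on_compose2[OF that]) (auto intro!: continuous_intros)
  have qc: "continuous_on UNIV (q h)" for h
    using cont_shift[OF f, of "h *\<^sub>R v"] cont_shift[OF f, of "- (h *\<^sub>R v)"] f
    \<comment> \<open>At \<open>h = 0\<close> division by zero makes the quotient identically
      0.\<close>
    by (cases "h = 0") (auto simp: q_def intro!: continuous_intros)
  have neg: "(LINT x|lborel. r x * q h x) \<le> 0" if h: "0 < h" "h \<le> e" for h
  proof -
    have shift: "(LINT x|lborel. r x * f (x + s *\<^sub>R v)) = (LINT x|lborel. r (x - s *\<^sub>R v) * f x)"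
      and int1: "integrable lborel (\<lambda>x. r x * f (x + s *\<^sub>R v))"
      and int2: "integrable lborel (\<lambda>x. r (x - s *\<^sub>R v) * f x)" if "\<bar>s\<bar> \<le> e" for s
    proof -
      have c1: "continuous_on UNIV (\<lambda>x. r x * f (x + s *\<^sub>R v))"
        by (intro continuous_intros r cont_shift f)
      show "(LINT x|lborel. r x * f (x + s *\<^sub>R v)) = (LINT x|lborel. r (x - s *\<^sub>R v) * f x)"
        using integral_lborel_translation[OF c1, of "- (s *\<^sub>R v)"] by (simp add: algebra_simps)
      show "integrable lborel (\<lambda>x. r x * f (x + s *\<^sub>R v))"
        using out[OF _ that] fK by (intro integrable_continuous_compact_support[OF c1 K']) auto
      have "continuous_on UNIV (\<lambda>x. r (x + (- (s *\<^sub>R v))) * f x)"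
        by (intro continuous_intros f cont_shift r)
      then show "integrable lborel (\<lambda>x. r (x - s *\<^sub>R v) * f x)"
        using fK by (intro integrable_continuous_compact_support[OF _ K]) auto
    qed
    have he: "\<bar>h\<bar> \<le> e" "\<bar>- h\<bar> \<le> e" "\<bar>0\<bar> \<le> e" using h by auto
    \<comment> \<open>The central term is written as a shift by 0, so that one rule
      \<open>shift\<close> treats all three terms.\<close>
    have "(LINT x|lborel. r x * q h x)
        = (LINT x|lborel. (r x * f (x + h *\<^sub>R v) + r x * f (x + (- h) *\<^sub>R v) - 2 * (r x * f (x + 0 *\<^sub>R v))) / h\<^sup>2)"
      by (intro Bochner_Integration.integral_cong) (simp_all add: q_def algebra_simps)
    also have "\<dots> = ((LINT x|lborel. r x * f (x + h *\<^sub>R v)) + (LINT x|lborel. r x * f (x + (- h) *\<^sub>R v))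
        - 2 * (LINT x|lborel. r x * f (x + 0 *\<^sub>R v))) / h\<^sup>2"
      using int1[OF he(1)] int1[OF he(2)] int1[OF he(3)] by simp
    also have "\<dots> = ((LINT x|lborel. r (x - h *\<^sub>R v) * f x) + (LINT x|lborel. r (x - (- h) *\<^sub>R v) * f x)
        - 2 * (LINT x|lborel. r (x - 0 *\<^sub>R v) * f x)) / h\<^sup>2"
      by (simp only: shift he)
    also have "\<dots> = (LINT x|lborel. r (x - h *\<^sub>R v) * f x + r (x - (- h) *\<^sub>R v) * f x - 2 * (r (x - 0 *\<^sub>R v) * f x)) / h\<^sup>2"
      using int2[OF he(1)] int2[OF he(2)] int2[OF he(3)] by simp
    also have "\<dots> \<le> 0"
    proof (intro divide_nonpos_pos)
      \<comment> \<open>The sign is pointwise: concavity multiplied by \<open>f x \<ge> 0\<close> on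
        \<open>K\<close>, and \<open>f x = 0\<close> elsewhere.\<close>
      have "0 \<le> (LINT x|lborel. - (r (x - h *\<^sub>R v) * f x + r (x - (- h) *\<^sub>R v) * f x - 2 * (r (x - 0 *\<^sub>R v) * f x)))"
      proof (intro Bochner_Integration.integral_nonneg)
        fix x
        show "0 \<le> - (r (x - h *\<^sub>R v) * f x + r (x - (- h) *\<^sub>R v) * f x - 2 * (r (x - 0 *\<^sub>R v) * f x))"
        proof (cases "x \<in> K")
          case True
          then have "(r (x + h *\<^sub>R v) + r (x - h *\<^sub>R v)) * f x \<le> (2 * r x) * f x"
            using concave h nonneg by (intro mult_right_mono) auto
          then show ?thesis by (simp add: algebra_simps)
        qed (simp add: fK)
      qed
      then show "(LINT x|lborel. r (x - h *\<^sub>R v) * f x + r (x - (- h) *\<^sub>R v) * f x - 2 * (r (x - 0 *\<^sub>R v) * f x)) \<le> 0"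
        by (simp only: Bochner_Integration.integral_minus neg_0_le_iff_le)
    qed (use h in auto)
    finally show ?thesis .
  qed
  define h where "h n = e / real (Suc n)" for n
  have h: "0 < h n" "h n \<le> e" for n
    using \<open>e > 0\<close> by (auto simp: h_def field_simps)
  have h0: "h \<longlonglongrightarrow> 0"
    unfolding h_def
    by (intro real_tendsto_divide_at_top[OF tendsto_const] filterlim_compose[OF filterlim_real_sequentially filterlim_Suc])
  have lim: "(\<lambda>n. q (h n) x) \<longlonglongrightarrow> f'' x" for x
  proof -
    have "\<forall>n. \<exists>s t. \<bar>s\<bar> \<le> h n \<and> \<bar>t\<bar> \<le> h n \<and> q (h n) x = (f'' (x + s *\<^sub>R v) + f'' (x + t *\<^sub>R v)) / 2"
      using mv h by blast
    then obtain s t where st: "\<And>n. \<bar>s n\<bar> \<le> h n" "\<And>n. \<bar>t n\<bar> \<le> h n"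
      and q: "\<And>n. q (h n) x = (f'' (x + s n *\<^sub>R v) + f'' (x + t n *\<^sub>R v)) / 2"
      by metis
    \<comment> \<open>The Taylor points are squeezed to \<open>x\<close> by the step, so continuity
      of \<open>f''\<close> suffices.\<close>
    have tend: "(\<lambda>n. f'' (x + u n *\<^sub>R v)) \<longlonglongrightarrow> f'' x" if "\<And>n. \<bar>u n\<bar> \<le> h n" for u
    proof -
      have "u \<longlonglongrightarrow> 0"
        by (rule Lim_null_comparison[OF _ h0]) (simp add: that)
      then have "(\<lambda>n. x + u n *\<^sub>R v) \<longlonglongrightarrow> x + 0 *\<^sub>R v" by (intro tendsto_intros)
      moreover have "isCont f'' x" using f'' by (simp add: continuous_on_eq_continuous_at)
      ultimately show ?thesis by (intro isCont_tendsto_compose[of x f'']) simp_all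
    qed
    have "(\<lambda>n. (f'' (x + s n *\<^sub>R v) + f'' (x + t n *\<^sub>R v)) / 2) \<longlonglongrightarrow> (f'' x + f'' x) / 2"
      by (intro tendsto_intros tend st) simp
    then show ?thesis by (simp add: q)
  qed
  have "(\<lambda>n. LINT x|lborel. r x * q (h n) x) \<longlonglongrightarrow> (LINT x|lborel. r x * f'' x)"
  proof (rule integral_dominated_convergence)
    show "(\<lambda>x. r x * f'' x) \<in> borel_measurable lborel"
      using r f'' by (auto intro!: borel_measurable_continuous_onI continuous_intros)
    show "(\<lambda>x. r x * q (h n) x) \<in> borel_measurable lborel" for n
      using r qc by (auto intro!: borel_measurable_continuous_onI continuous_intros)
    show "integrable lborel (\<lambda>x. indicator K' x *\<^sub>R (\<bar>r x\<bar> * B))"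
      by (intro borel_integrable_compact[OF K'] continuous_intros continuous_on_subset[OF r]) auto
    show "AE x in lborel. (\<lambda>n. r x * q (h n) x) \<longlonglongrightarrow> r x * f'' x"
      by (intro AE_I2 tendsto_intros lim)
    show "AE x in lborel. norm (r x * q (h n) x) \<le> indicator K' x *\<^sub>R (\<bar>r x\<bar> * B)" for n
    proof (intro AE_I2)
      fix x
      show "norm (r x * q (h n) x) \<le> indicator K' x *\<^sub>R (\<bar>r x\<bar> * B)"
        using qB[of "h n" x] q0[of "h n" x] h[of n]
        by (cases "x \<in> K'") (auto simp: abs_mult mult_left_mono)
    qed
  qed
  then show ?thesis
    by (rule LIMSEQ_le_const2) (use neg h in blast)
qed

section \<open>Partial derivatives of test functions\<close>

lemma C_infinity_partial_deriv: "C_infinity f \<Longrightarrow> C_infinity (partial_deriv i f)"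
  unfolding C_infinity_def by (metis C_order.simps(2))

lemma C_infinity_continuous_on: "C_infinity f \<Longrightarrow> continuous_on UNIV f"
  unfolding C_infinity_def by (metis C_order.simps(1))

lemma C_infinity_differentiable: "C_infinity f \<Longrightarrow> f differentiable (at x)"
  unfolding C_infinity_def by (metis C_order.simps(2))

lemma partial_deriv_eq_0_outside:
  assumes "closed K" "\<And>x. x \<notin> K \<Longrightarrow> f x = 0" "x \<notin> K"
  shows "partial_deriv i f x = 0"
proof -
  have "(f has_derivative (\<lambda>_. 0)) (at x)"
    by (rule has_derivative_transform_within_open[where f = "\<lambda>_. 0" and s = "- K"])
      (use assms in auto)
  then show ?thesis
    by (simp add: partial_deriv_def frechet_derivative_at[symmetric])
qed

text \<open>The chain rule, with the differential at \<open>v\<close> expanded in the standard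
  basis. In this form it applies again to each \<open>partial_deriv i f\<close>, which yields the
  second derivative along the line.\<close>

lemma has_real_derivative_along_line:
  fixes f :: "real ^ 'n::finite \<Rightarrow> real"
  assumes "f differentiable (at (x + t *\<^sub>R v))"
  shows "((\<lambda>t. f (x + t *\<^sub>R v)) has_real_derivative
    (\<Sum>i\<in>UNIV. v $ i * partial_deriv i f (x + t *\<^sub>R v))) (at t)"
proof -
  let ?D = "frechet_derivative f (at (x + t *\<^sub>R v))"
  have D: "(f has_derivative ?D) (at (x + t *\<^sub>R v))"
    using assms by (simp add: frechet_derivative_works)
  have lin: "linear ?D" using has_derivative_linear[OF D] .
  have "?D v = ?D (\<Sum>i\<in>UNIV. v $ i *\<^sub>R axis i 1)"
    using basis_expansion[of v] by (simp add: scalar_mult_eq_scaleR)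
  also have "\<dots> = (\<Sum>i\<in>UNIV. v $ i * partial_deriv i f (x + t *\<^sub>R v))"
    by (simp add: linear_sum[OF lin] linear_cmul[OF lin] partial_deriv_def)
  finally have Dv: "?D v = \<dots>" .
  have "((\<lambda>t. x + t *\<^sub>R v) has_derivative (\<lambda>s. s *\<^sub>R v)) (at t)"
    by (auto intro!: derivative_eq_intros)
  from has_derivative_compose[OF this D]
  have "((\<lambda>t. f (x + t *\<^sub>R v)) has_derivative (\<lambda>s. ?D (s *\<^sub>R v))) (at t)" .
  also have "(\<lambda>s. ?D (s *\<^sub>R v)) = (*) (\<Sum>i\<in>UNIV. v $ i * partial_deriv i f (x + t *\<^sub>R v))"
    by (auto simp: linear_cmul[OF lin] Dv)
  finally show ?thesis by (simp add: has_field_derivative_def)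
qed

text \<open>Vanishing of \<open>g\<close> off \<Omega> removes the restriction to \<Omega>, and the
  continuous integrand is Borel, so completing the measure does not change the integral.\<close>

lemma distr_of_fun_eq_lborel:
  fixes f g :: "real ^ 'n::finite \<Rightarrow> real"
  assumes "continuous_on UNIV f" "continuous_on UNIV g" "\<And>x. x \<notin> \<Omega> \<Longrightarrow> g x = 0"
  shows "distr_of_fun \<Omega> f g = (LINT x|lborel. f x * g x)"
proof -
  have "distr_of_fun \<Omega> f g = (LINT x|lebesgue. f x * g x)"
    unfolding distr_of_fun_def set_lebesgue_integral_def
    using assms(3) by (intro Bochner_Integration.integral_cong) (auto simp: indicator_def)
  also have "\<dots> = (LINT x|lborel. f x * g x)"
    using assms by (intro integral_completion) (auto intro!: borel_measurable_continuous_onI continuous_intros)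
  finally show ?thesis .
qed

section \<open>Reduction of the distributional inequality to pure second derivatives of the test
  function\<close>

theorem theorem6p10:
  fixes \<Omega> :: "(real ^ 'n::finite) set" and \<alpha> :: "real ^ 'n ^ 'n"
  assumes "CARD('n) \<ge> 2"
    and "open \<Omega>" and "connected \<Omega>" and "\<Omega> \<noteq> {}"
    and "convex \<Omega>" and "\<Omega> \<noteq> UNIV"
    and "\<alpha> \<in> (\<Union>\<nu>\<in>{0<..1}. elliptic_matrices (\<nu>\<^sup>2) 1)"
  shows "distr_nonpos \<Omega>
    (\<lambda>\<zeta>. \<Sum>i\<in>UNIV. \<Sum>j\<in>UNIV.
      \<alpha> $ i $ j * distr_deriv i (distr_deriv j (distr_of_fun \<Omega> (bdry_dist \<Omega>))) \<zeta>)"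
  unfolding distr_nonpos_def
proof (intro ballI impI)
  fix \<zeta> :: "real ^ 'n \<Rightarrow> real"
  assume \<zeta>: "\<zeta> \<in> test_functions \<Omega>" and nonneg: "\<forall>x. 0 \<le> \<zeta> x"
  define K where "K = closure {x. \<zeta> x \<noteq> 0}"
  have smooth: "C_infinity \<zeta>" and K: "compact K" "closed K" "K \<subseteq> \<Omega>"
    using \<zeta> by (auto simp: test_functions_def K_def)
  have \<zeta>K: "\<zeta> x = 0" if "x \<notin> K" for x
    using that closure_subset[of "{x. \<zeta> x \<noteq> 0}"] by (auto simp: K_def)
  \<comment> \<open>The outer \<open>distr_deriv i\<close> reaches \<zeta> first, hence this order
    of indices; the two minus signs cancel.\<close>
  define D2 where "D2 i j = partial_deriv j (partial_deriv i \<zeta>)" for i j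
  have D2c: "continuous_on UNIV (D2 i j)" for i j
    unfolding D2_def by (intro C_infinity_continuous_on C_infinity_partial_deriv smooth)
  have D2K: "D2 i j x = 0" if "x \<notin> K" for i j x
    unfolding D2_def using K(2) \<zeta>K that by (intro partial_deriv_eq_0_outside[of K]) auto
  have \<rho>: "continuous_on UNIV (bdry_dist \<Omega>)"
    unfolding bdry_dist_def by (intro continuous_intros)
  define L where "L i j = (LINT x|lborel. bdry_dist \<Omega> x * D2 i j x)" for i j
  have act: "distr_deriv i (distr_deriv j (distr_of_fun \<Omega> (bdry_dist \<Omega>))) \<zeta> = L i j" for i j
    using distr_of_fun_eq_lborel[OF \<rho> D2c[of i j], of \<Omega>] D2K K(3)
    by (auto simp: distr_deriv_def L_def D2_def)
  have "(\<Sum>i\<in>UNIV. \<Sum>j\<in>UNIV. v $ i * v $ j * L i j) \<le> 0" for v :: "real ^ 'n"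
  proof -
    obtain \<delta> where \<delta>: "\<delta> > 0" "(\<Union>x\<in>K. cball x \<delta>) \<subseteq> \<Omega>"
      using compact_subset_open_imp_cball_epsilon_subset[OF K(1) \<open>open \<Omega>\<close> K(3)] .
    \<comment> \<open>Steps up to \<open>e\<close> along \<open>v\<close> move points of
      \<open>K\<close> by at most \<delta>, so they stay in \<Omega>. The added 1 keeps the
      denominator positive when \<open>v = 0\<close>.\<close>
    define e where "e = \<delta> / (norm v + 1)"
    have v1: "norm v + 1 > 0" using norm_ge_zero[of v] by linarith
    have e: "e > 0" "e * norm v \<le> \<delta>"
      using \<delta>(1) v1 by (simp_all add: e_def pos_divide_le_eq)
    have int: "integrable lborel (\<lambda>x. bdry_dist \<Omega> x * D2 i j x)" for i j
      using D2K by (intro integrable_continuous_compact_support[OF _ K(1)] continuous_intros \<rho> D2c) auto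
    let ?f'' = "\<lambda>x. \<Sum>i\<in>UNIV. v $ i * (\<Sum>j\<in>UNIV. v $ j * D2 i j x)"
    \<comment> \<open>By linearity the quadratic form of \<open>L\<close> at \<open>v\<close> is the
      distance integrated against the second derivative of \<zeta> along \<open>v\<close>.\<close>
    have "(\<Sum>i\<in>UNIV. \<Sum>j\<in>UNIV. v $ i * v $ j * L i j)
        = (LINT x|lborel. (\<Sum>i\<in>UNIV. \<Sum>j\<in>UNIV. v $ i * v $ j * (bdry_dist \<Omega> x * D2 i j x)))"
      unfolding L_def using int by simp
    also have "\<dots> = (LINT x|lborel. bdry_dist \<Omega> x * ?f'' x)"
      by (intro Bochner_Integration.integral_cong refl) (simp add: sum_distrib_left mult_ac)
    also have "\<dots> \<le> 0"
    proof (rule second_derivative_integral_nonpos[where K = K and e = e and f = \<zeta> and v = v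
          and f' = "\<lambda>x. \<Sum>i\<in>UNIV. v $ i * partial_deriv i \<zeta> x"])
      show "((\<lambda>t. \<zeta> (x + t *\<^sub>R v)) has_real_derivative
          (\<Sum>i\<in>UNIV. v $ i * partial_deriv i \<zeta> (x + t *\<^sub>R v))) (at t)" for x t
        by (intro has_real_derivative_along_line C_infinity_differentiable smooth)
      show "((\<lambda>t. \<Sum>i\<in>UNIV. v $ i * partial_deriv i \<zeta> (x + t *\<^sub>R v)) has_real_derivative
          ?f'' (x + t *\<^sub>R v)) (at t)" for x t
        unfolding D2_def
        by (intro DERIV_sum DERIV_cmult has_real_derivative_along_line C_infinity_differentiable
            C_infinity_partial_deriv smooth)
      show "bdry_dist \<Omega> (x + h *\<^sub>R v) + bdry_dist \<Omega> (x - h *\<^sub>R v) \<le> 2 * bdry_dist \<Omega> x"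
        if "x \<in> K" "0 < h" "h \<le> e" for x h
      proof -
        have "h * norm v \<le> \<delta>"
          using that e(2) by (meson mult_right_mono norm_ge_zero order_trans)
        then have "x + h *\<^sub>R v \<in> cball x \<delta>" "x - h *\<^sub>R v \<in> cball x \<delta>"
          using that by (auto simp: dist_norm)
        then have "x + h *\<^sub>R v \<in> \<Omega>" "x - h *\<^sub>R v \<in> \<Omega>"
          using \<delta>(2) that(1) by blast+
        then show ?thesis
          unfolding bdry_dist_def
          using assms by (intro infdist_frontier_midpoint_concave) auto
      qed
    qed (use \<rho> D2c D2K \<zeta>K K(1) e(1) nonneg C_infinity_continuous_on[OF smooth]
        in \<open>auto intro!: continuous_intros\<close>)
    finally show ?thesis .
  qed
  moreover from assms(7) obtain \<nu> where \<alpha>: "\<alpha> \<in> elliptic_matrices (\<nu>\<^sup>2) 1" by blast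
  then have "transpose \<alpha> = \<alpha>" by (simp add: elliptic_matrices_def)
  \<comment> \<open>Semidefiniteness comes from the lower ellipticity bound.\<close>
  moreover have "0 \<le> (\<Sum>i\<in>UNIV. \<Sum>j\<in>UNIV. \<alpha> $ i $ j * \<xi> $ i * \<xi> $ j)" for \<xi> :: "real ^ 'n"
  proof -
    have "0 \<le> \<nu>\<^sup>2 * (norm \<xi>)\<^sup>2" by simp
    also have "\<dots> \<le> (\<Sum>i\<in>UNIV. \<Sum>j\<in>UNIV. \<alpha> $ i $ j * \<xi> $ i * \<xi> $ j)"
      using \<alpha> by (simp add: elliptic_matrices_def)
    finally show ?thesis .
  qed
  ultimately show "(\<Sum>i\<in>UNIV. \<Sum>j\<in>UNIV.
      \<alpha> $ i $ j * distr_deriv i (distr_deriv j (distr_of_fun \<Omega> (bdry_dist \<Omega>))) \<zeta>) \<le> 0"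
    unfolding act by (intro psd_contraction_nonpos)
qed

end
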